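(* Let $\mathscr{A}$ be a (finite-dimensional) formally real Jordan algebra and let $\langle\cdot,\cdot\rangle$ be an associative inner product on $\mathscr{A}$. Then $$\langle XY,XY\rangle\le\langle X^2,Y^2\rangle\quad\text{for all }X,Y\in\mathscr{A}.$$
   Context: A (real) Jordan algebra is a real vector space $\mathscr{A}$ with a bilinear product satisfying $XY=YX$ and $X(X^2Y)=X^2(XY)$. It is formally real if it has an identity element and $X^2+Y^2=0$ implies $X=Y=0$. An inner product (positive definite symmetric bilinear form) is associative if $\langle XY,Z\rangle=\langle X,YZ\rangle$ for all $X,Y,Z\in\mathscr{A}$. *)

theory Defs
  imports "HOL-Analysis.Analysis"
begin

text \<open>
  The Jordan product is a parameter, not the class operation \<open>(*)\<close>, since the class
  \<open>real_algebra\<close> would force it to be associative.  Likewise the inner product is a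
  parameter, not the operation of the class \<open>real_inner\<close>, so that no norm or topology has to
  be attached to the underlying vector space.
\<close>

locale jordan_algebra =
  fixes jprod :: "'a::real_vector \<Rightarrow> 'a \<Rightarrow> 'a"  (infixl \<open>\<bullet>\<^sub>J\<close> 70)
  assumes jprod_bilinear: "bilinear jprod"
    and jprod_commute: "x \<bullet>\<^sub>J y = y \<bullet>\<^sub>J x"
    and jordan_identity: "x \<bullet>\<^sub>J ((x \<bullet>\<^sub>J x) \<bullet>\<^sub>J y) = (x \<bullet>\<^sub>J x) \<bullet>\<^sub>J (x \<bullet>\<^sub>J y)"

locale formally_real_jordan_algebra = jordan_algebra +
  assumes identity_exists: "\<exists>e. \<forall>x. e \<bullet>\<^sub>J x = x \<and> x \<bullet>\<^sub>J e = x"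
    and formally_real: "x \<bullet>\<^sub>J x + y \<bullet>\<^sub>J y = 0 \<Longrightarrow> x = 0 \<and> y = 0"

definition inner_product :: "('a::real_vector \<Rightarrow> 'a \<Rightarrow> real) \<Rightarrow> bool" where
  "inner_product ip \<longleftrightarrow>
     bilinear ip \<and> (\<forall>x y. ip x y = ip y x) \<and> (\<forall>x. x \<noteq> 0 \<longrightarrow> 0 < ip x x)"

definition associative_form ::
    "('a::real_vector \<Rightarrow> 'a \<Rightarrow> 'a) \<Rightarrow> ('a \<Rightarrow> 'a \<Rightarrow> real) \<Rightarrow> bool" where
  "associative_form jprod ip \<longleftrightarrow> (\<forall>x y z. ip (jprod x y) z = ip x (jprod y z))"

end

theory Submission
  imports Defs "HOL-Computational_Algebra.Fundamental_Theorem_Algebra"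
begin

text \<open>
  Write \<open>L(X)\<close> for multiplication by \<open>X\<close>.  Associativity of the form says that \<open>L(X)\<close> is
  symmetric, so the inequality states that the symmetric operator \<open>D = L(X\<^sup>2) - L(X)\<^sup>2\<close> is positive
  semidefinite.  The Jordan identity says that \<open>L(X)\<close> and \<open>L(X\<^sup>2)\<close> commute, so \<open>D\<close> and
  \<open>L(X)\<close> can be diagonalized simultaneously, and it suffices to show \<open>m \<ge> 0\<close> whenever
  \<open>v \<noteq> 0\<close>, \<open>D v = m v\<close> and \<open>X v = a v\<close> (\<open>commuting_symmetric_nonneg\<close>).

  On such a \<open>v\<close>, the element \<open>Z = X - a e\<close>, with \<open>e\<close> the identity element, satisfies \<open>Z v = 0\<close> and
  \<open>Z\<^sup>2 v = m v\<close>.  Two linearizations of the Jordan identity give \<open>Z (Z v\<^sup>2) = v (Z\<^sup>2 v) = m v\<^sup>2\<close>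
  (\<open>jprod_square_of_kernel\<close>).  Pairing with \<open>v\<^sup>2\<close> yields \<open>\<bar>Z v\<^sup>2\<bar>\<^sup>2 = m \<bar>v\<^sup>2\<bar>\<^sup>2\<close>, where
  \<open>v\<^sup>2 \<noteq> 0\<close> because its inner product with \<open>e\<close> is \<open>\<bar>v\<bar>\<^sup>2\<close>.  Hence \<open>m \<ge> 0\<close>.  This argument
  takes the place of the spectral theorem and the Peirce decomposition of the algebra, by which \<open>D\<close>
  has the eigenvalues \<open>(\<lambda>\<^sub>i - \<lambda>\<^sub>j)\<^sup>2 / 4\<close>, the \<open>\<lambda>\<^sub>i\<close> being the spectral values of \<open>X\<close>.

  The inner product is an arbitrary form rather than that of a normed space, so eigenvectors are
  found algebraically, from a real polynomial annihilating a vector, and not by maximizing a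
  quadratic form over a sphere.
\<close>

section \<open>Polynomials of an operator\<close>

text \<open>The value \<open>p(T) v\<close>, in Horner form so that proofs go by induction along \<open>pCons\<close>.\<close>

definition poly_op :: "('a::real_vector \<Rightarrow> 'a) \<Rightarrow> real poly \<Rightarrow> 'a \<Rightarrow> 'a" where
  "poly_op T p v = fold_coeffs (\<lambda>a w. a *\<^sub>R v + T w) p 0"

lemma poly_op_0 [simp]: "poly_op T 0 v = 0"
  by (simp add: poly_op_def)

lemma poly_op_pCons:
  assumes "linear T"
  shows "poly_op T (pCons a p) v = a *\<^sub>R v + T (poly_op T p v)"
  by (cases "p = 0 \<and> a = 0") (auto simp: poly_op_def linear_0[OF assms])

lemma poly_op_add:
  assumes "linear T"
  shows "poly_op T (p + q) v = poly_op T p v + poly_op T q v"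
  by (induction p q rule: poly_induct2)
    (simp_all add: poly_op_pCons[OF assms] linear_add[OF assms] algebra_simps)

lemma poly_op_smult:
  assumes "linear T"
  shows "poly_op T (smult a p) v = a *\<^sub>R poly_op T p v"
  by (induction p)
    (simp_all add: poly_op_pCons[OF assms] linear_scale[OF assms] algebra_simps)

lemma poly_op_diff:
  assumes "linear T"
  shows "poly_op T (p - q) v = poly_op T p v - poly_op T q v"
  using poly_op_add[OF assms, of p "- q" v] poly_op_smult[OF assms, of "- 1" q v] by simp

lemma poly_op_mult:
  assumes "linear T"
  shows "poly_op T (p * q) v = poly_op T p (poly_op T q v)"
  by (induction p)
    (simp_all add: poly_op_pCons[OF assms] poly_op_add[OF assms] poly_op_smult[OF assms])

lemma poly_op_monom:
  assumes "linear T"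
  shows "poly_op T (monom a n) v = a *\<^sub>R (T ^^ n) v"
  by (induction n)
    (simp_all add: monom_0 monom_Suc poly_op_pCons[OF assms] linear_0[OF assms] linear_scale[OF assms])

lemma poly_op_sum:
  assumes "linear T"
  shows "poly_op T (\<Sum>i\<in>I. f i) v = (\<Sum>i\<in>I. poly_op T (f i) v)"
  by (induction I rule: infinite_finite_induct) (simp_all add: poly_op_add[OF assms])

lemma poly_op_closed:
  assumes "linear T" "subspace U" "T ` U \<subseteq> U" "v \<in> U"
  shows "poly_op T p v \<in> U"
proof (induction p)
  case 0
  show ?case using subspace_0[OF assms(2)] by simp
next
  case (pCons a p)
  then show ?case
    using assms by (auto simp: poly_op_pCons[OF assms(1)] intro!: subspace_add subspace_scale)
qed

text \<open>
  The vectors \<open>v, T v, T\<^sup>2 v, \<dots>\<close> cannot all be distinct and linearly independent; a coincidence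
  or a linear dependence among them is such a polynomial.
\<close>

lemma annihilating_polynomial_exists:
  fixes T :: "'a::real_vector \<Rightarrow> 'a"
  assumes fin: "finite_dimensional_vector_space (scaleR :: real \<Rightarrow> 'a \<Rightarrow> 'a) B"
    and T: "linear T"
  obtains p where "p \<noteq> 0" "poly_op T p v = 0"
proof (cases "inj (\<lambda>n. (T ^^ n) v)")
  case False
  then obtain i j where ij: "i \<noteq> j" "(T ^^ i) v = (T ^^ j) v"
    by (auto simp: inj_on_def)
  have "monom (1::real) i - monom 1 j \<noteq> 0"
    using ij(1) by (auto simp: monom_eq_iff')
  moreover have "poly_op T (monom 1 i - monom 1 j) v = 0"
    using ij(2) by (simp add: poly_op_diff[OF T] poly_op_monom[OF T])
  ultimately show thesis by (rule that)
next
  case True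
  let ?g = "\<lambda>n. (T ^^ n) v"
  interpret finite_dimensional_vector_space "scaleR :: real \<Rightarrow> 'a \<Rightarrow> 'a" B by (rule fin)
  have "infinite (range ?g)" using True by (simp add: finite_image_iff)
  then have "dependent (range ?g)" using finiteI_independent unfolding dependent_raw_def by blast
  then obtain S u x where S: "finite S" "S \<subseteq> range ?g" "(\<Sum>w\<in>S. u w *\<^sub>R w) = 0" "x \<in> S" "u x \<noteq> 0"
    unfolding dependent_explicit by blast
  from finite_subset_image[OF S(1,2)] obtain I where I: "finite I" "S = ?g ` I" by blast
  then obtain k where k: "k \<in> I" "x = ?g k" using S(4) by blast
  define p where "p = (\<Sum>i\<in>I. monom (u (?g i)) i)"
  have "coeff p k = u x"
    using k I(1) by (simp add: p_def coeff_sum if_distrib cong: if_cong)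
  then have "p \<noteq> 0" using S(5) by auto
  moreover have "poly_op T p v = (\<Sum>i\<in>I. u (?g i) *\<^sub>R ?g i)"
    by (simp add: p_def poly_op_sum[OF T] poly_op_monom[OF T])
  moreover have "\<dots> = (\<Sum>w\<in>S. u w *\<^sub>R w)"
    unfolding I(2) using True by (subst sum.reindex) (auto simp: inj_on_def)
  ultimately show thesis using that S(3) by simp
qed

lemma poly_map_poly_of_real_add:
  fixes p q :: "real poly"
  shows "poly (map_poly complex_of_real (p + q)) z =
    poly (map_poly complex_of_real p) z + poly (map_poly complex_of_real q) z"
  by (induction p q rule: poly_induct2) (simp_all add: map_poly_pCons algebra_simps)

lemma poly_map_poly_of_real_mult:
  fixes p q :: "real poly"
  shows "poly (map_poly complex_of_real (p * q)) z =
    poly (map_poly complex_of_real p) z * poly (map_poly complex_of_real q) z"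
  by (induction p)
    (simp_all add: map_poly_pCons map_poly_smult poly_map_poly_of_real_add algebra_simps)

lemma poly_map_poly_of_real_of_real:
  fixes p :: "real poly"
  shows "poly (map_poly complex_of_real p) (of_real a) = of_real (poly p a)"
  by (induction p) (simp_all add: map_poly_pCons)

text \<open>
  A complex root \<open>z\<close> gives the factor: \<open>X - z\<close> if \<open>z\<close> is real, and otherwise
  \<open>(X - z) (X - cnj z)\<close>, because the remainder modulo this quadratic is a real polynomial of
  degree at most one with a non-real root, hence zero.
\<close>

lemma real_poly_linear_or_quadratic_factor:
  fixes p :: "real poly"
  assumes "degree p > 0"
  obtains a q where "p = [:- a, 1:] * q"
    | a b q where "b \<noteq> 0" "p = [:a\<^sup>2 + b\<^sup>2, - 2 * a, 1:] * q"
proof -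
  have "degree (map_poly complex_of_real p) > 0"
    using assms by (simp add: degree_map_poly)
  then obtain z where z: "poly (map_poly complex_of_real p) z = 0"
    using fundamental_theorem_of_algebra[of "map_poly complex_of_real p"]
    by (auto simp: constant_degree)
  show thesis
  proof (cases "Im z = 0")
    case True
    then have "z = of_real (Re z)" by (simp add: complex_eq_iff)
    then have "complex_of_real (poly p (Re z)) = 0"
      using z by (metis poly_map_poly_of_real_of_real) 
    then have "[:- Re z, 1:] dvd p" by (simp add: poly_eq_0_iff_dvd)
    then show thesis using that(1) by (auto elim: dvdE)
  next
    case False
    define Q where "Q = [:(Re z)\<^sup>2 + (Im z)\<^sup>2, - 2 * Re z, 1:]"
    define r where "r = p mod Q"
    have Qz: "poly (map_poly complex_of_real Q) z = 0"
      by (simp add: Q_def map_poly_pCons complex_eq_iff power2_eq_square algebra_simps)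
    have "p = Q * (p div Q) + r" by (simp add: r_def)
    then have rz: "poly (map_poly complex_of_real r) z = 0"
      using z Qz by (metis poly_map_poly_of_real_add poly_map_poly_of_real_mult mult_zero_left add_0)
    have "Q \<noteq> 0" "degree Q = 2" by (simp_all add: Q_def)
    then have "degree r < 2" using degree_mod_less[of Q p] by (auto simp: r_def)
    then obtain c d where r: "r = [:c, d:]"
      by (metis One_nat_def degree_0 degree_pCons_eq_if degree_eq_zeroE less_2_cases pCons_cases  nat.inject)
    have "d = 0" "c = 0"
      using rz False by (auto simp: r map_poly_pCons complex_eq_iff)
    then have "p = Q * (p div Q)" using \<open>p = Q * (p div Q) + r\<close> r by simp
    then show thesis using that(2) False Q_def by blast
  qed
qed

section \<open>Symmetric operators in finite dimension\<close>

lemma inner_product_pos: "inner_product ip \<Longrightarrow> x \<noteq> 0 \<Longrightarrow> 0 < ip x x"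
  by (simp add: inner_product_def)

definition symmetric_operator ::
    "('a::real_vector \<Rightarrow> 'a \<Rightarrow> real) \<Rightarrow> ('a \<Rightarrow> 'a) \<Rightarrow> bool" where
  "symmetric_operator ip T \<longleftrightarrow> linear T \<and> (\<forall>x y. ip (T x) y = ip x (T y))"

text \<open>
  Among all pairs of a nonzero polynomial and a nonzero vector of \<open>U\<close> that it annihilates, take
  one with \<open>p\<close> of least degree.  Dividing a factor out of \<open>p\<close> then leaves a nonzero vector \<open>w\<close>
  killed by that factor.  A linear factor makes \<open>w\<close> an eigenvector; a quadratic factor
  \<open>(T - a)\<^sup>2 + b\<^sup>2\<close> with \<open>b \<noteq> 0\<close> cannot kill \<open>w\<close>, since by symmetry this would give
  \<open>\<bar>(T - a) w\<bar>\<^sup>2 + b\<^sup>2 \<bar>w\<bar>\<^sup>2 = 0\<close>.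
\<close>

lemma symmetric_operator_eigenvector:
  fixes T :: "'a::real_vector \<Rightarrow> 'a"
  assumes fin: "finite_dimensional_vector_space (scaleR :: real \<Rightarrow> 'a \<Rightarrow> 'a) B"
    and ip: "inner_product ip" and T: "symmetric_operator ip T"
    and U: "subspace U" "T ` U \<subseteq> U" "U \<noteq> {0}"
  obtains v a where "v \<in> U" "v \<noteq> 0" "T v = a *\<^sub>R v"
proof -
  have lin: "linear T" using T by (simp add: symmetric_operator_def)
  have bil: "bilinear ip" using ip by (simp add: inner_product_def)
  define P where "P n \<longleftrightarrow> (\<exists>p v. degree p = n \<and> p \<noteq> 0 \<and> v \<in> U \<and> v \<noteq> 0 \<and> poly_op T p v = 0)" for n
  obtain v0 where v0: "v0 \<in> U" "v0 \<noteq> 0" using U(1,3) subspace_0 by blast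
  obtain p0 where "p0 \<noteq> 0" "poly_op T p0 v0 = 0"
    by (rule annihilating_polynomial_exists[OF fin lin])
  then have "P (degree p0)" unfolding P_def using v0 by blast
  then have "P (LEAST n. P n)" by (rule LeastI)
  then obtain p v where p: "degree p = (LEAST n. P n)" "p \<noteq> 0" "v \<in> U" "v \<noteq> 0" "poly_op T p v = 0"
    unfolding P_def by blast
  have small: "poly_op T q v \<noteq> 0" if "q \<noteq> 0" "degree q < degree p" for q
    using not_less_Least[of "degree q" P] that p unfolding P_def by auto
  have "degree p \<noteq> 0"
  proof
    assume "degree p = 0"
    then obtain c where "p = [:c:]" by (rule degree_eq_zeroE)
    then show False using p by (simp add: poly_op_pCons[OF lin] linear_0[OF lin])
  qed
  then have "degree p > 0" by simp
  then show thesis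
  proof (cases rule: real_poly_linear_or_quadratic_factor)
    case (1 a q)
    then have "q \<noteq> 0" using p(2) by auto
    then have "degree p = Suc (degree q)" unfolding 1 by (subst degree_mult_eq) auto
    then have w: "poly_op T q v \<noteq> 0" using small \<open>q \<noteq> 0\<close> by simp
    have "T (poly_op T q v) = a *\<^sub>R poly_op T q v"
      using p(5) unfolding 1
      by (simp add: poly_op_mult[OF lin] poly_op_pCons[OF lin] linear_0[OF lin] del: mult_pCons_left)
    then show thesis using that w poly_op_closed[OF lin U(1,2) p(3)] by blast
  next
    case (2 a b q)
    then have "q \<noteq> 0" using p(2) by auto
    then have "degree p = degree q + 2" unfolding 2 by (subst degree_mult_eq) auto
    define w where "w = poly_op T q v"
    have w: "w \<noteq> 0" using small \<open>q \<noteq> 0\<close> \<open>degree p = degree q + 2\<close> by (simp add: w_def)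
    define u where "u = T w - a *\<^sub>R w"
    \<comment> \<open>With \<open>u = (T - a) w\<close> the quadratic factor gives \<open>(T - a) u = - b\<^sup>2 w\<close>, so that the inner
      product of \<open>u\<close> with itself is negative.\<close>
    have "(a\<^sup>2 + b\<^sup>2) *\<^sub>R w + T (- (2 * a) *\<^sub>R w + T w) = 0"
      using p(5) unfolding 2 w_def
      by (simp add: poly_op_mult[OF lin] poly_op_pCons[OF lin] linear_0[OF lin] del: mult_pCons_left)
    then have "T (T w) = (2 * a) *\<^sub>R T w - (a\<^sup>2 + b\<^sup>2) *\<^sub>R w"
      by (simp add: linear_add[OF lin] linear_diff[OF lin] linear_scale[OF lin] linear_neg[OF lin]
          algebra_simps)
    moreover have "(2 * a) *\<^sub>R T w = a *\<^sub>R T w + a *\<^sub>R T w"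
      by (simp flip: scaleR_add_left)
    ultimately have eq: "T u - a *\<^sub>R u = - (b\<^sup>2 *\<^sub>R w)"
      by (simp add: u_def linear_diff[OF lin] linear_scale[OF lin] power2_eq_square
          scaleR_add_left scaleR_diff_right)
    have "ip (T w - a *\<^sub>R w) u = ip w (T u - a *\<^sub>R u)"
      using T by (simp add: symmetric_operator_def bilinear_lsub[OF bil] bilinear_rsub[OF bil]
          bilinear_lmul[OF bil] bilinear_rmul[OF bil])
    then have "ip u u = ip w (T u - a *\<^sub>R u)"
      by (simp flip: u_def)
    also have "\<dots> = - (b\<^sup>2 * ip w w)"
      unfolding eq by (simp add: bilinear_rneg[OF bil] bilinear_rmul[OF bil])
    also have "\<dots> < 0" using inner_product_pos[OF ip w] 2(1) by simp
    finally have "ip u u < 0" .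
    then show thesis
      using inner_product_pos[OF ip, of u] bilinear_lzero[OF bil, of 0] by (cases "u = 0") auto
  qed
qed

text \<open>The second operator preserves each eigenspace of the first, and so has an eigenvector in it.\<close>

lemma commuting_symmetric_joint_eigenvector:
  fixes D T :: "'a::real_vector \<Rightarrow> 'a"
  assumes fin: "finite_dimensional_vector_space (scaleR :: real \<Rightarrow> 'a \<Rightarrow> 'a) B"
    and ip: "inner_product ip"
    and D: "symmetric_operator ip D" and T: "symmetric_operator ip T"
    and comm: "\<And>x. D (T x) = T (D x)"
    and U: "subspace U" "D ` U \<subseteq> U" "T ` U \<subseteq> U" "U \<noteq> {0}"
  obtains v m a where "v \<in> U" "v \<noteq> 0" "D v = m *\<^sub>R v" "T v = a *\<^sub>R v"
proof -
  have lin: "linear D" "linear T" using D T by (simp_all add: symmetric_operator_def)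
  obtain w m where w: "w \<in> U" "w \<noteq> 0" "D w = m *\<^sub>R w"
    by (rule symmetric_operator_eigenvector[OF fin ip D U(1,2,4)])
  define E where "E = {x \<in> U. D x = m *\<^sub>R x}"
  have "subspace E"
    using U(1) by (auto simp: E_def subspace_def linear_0[OF lin(1)] linear_add[OF lin(1)]
        linear_scale[OF lin(1)] scaleR_add_right)
  moreover have "T ` E \<subseteq> E"
    using U(3) by (auto simp: E_def comm linear_scale[OF lin(2)])
  moreover have "E \<noteq> {0}" using w by (auto simp: E_def)
  ultimately obtain v a where "v \<in> E" "v \<noteq> 0" "T v = a *\<^sub>R v"
    by (rule symmetric_operator_eigenvector[OF fin ip T])
  then show thesis using that by (auto simp: E_def)
qed

text \<open>
  This is simultaneous diagonalization in the form needed later: a joint eigenvector is split off,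
  its orthogonal complement is again invariant under both operators, and the quadratic form of
  \<open>D\<close> is the sum of its values on the two parts.
\<close>

lemma commuting_symmetric_nonneg:
  fixes D T :: "'a::real_vector \<Rightarrow> 'a"
  assumes fin: "finite_dimensional_vector_space (scaleR :: real \<Rightarrow> 'a \<Rightarrow> 'a) B"
    and ip: "inner_product ip"
    and D: "symmetric_operator ip D" and T: "symmetric_operator ip T"
    and comm: "\<And>x. D (T x) = T (D x)"
    and joint: "\<And>v m a. v \<noteq> 0 \<Longrightarrow> D v = m *\<^sub>R v \<Longrightarrow> T v = a *\<^sub>R v \<Longrightarrow> 0 \<le> m"
  shows "0 \<le> ip (D y) y"
proof -
  have lin: "linear D" "linear T" using D T by (simp_all add: symmetric_operator_def)
  have sym: "ip (D x) z = ip x (D z)" "ip (T x) z = ip x (T z)" for x z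
    using D T by (simp_all add: symmetric_operator_def)
  have bil: "bilinear ip" and ip_comm: "ip x z = ip z x" for x z
    using ip by (simp_all add: inner_product_def)
  note bil_simps = bilinear_ladd[OF bil] bilinear_radd[OF bil] bilinear_lsub[OF bil] bilinear_rsub[OF bil]
    bilinear_lmul[OF bil] bilinear_rmul[OF bil] bilinear_lzero[OF bil] bilinear_rzero[OF bil]
  interpret finite_dimensional_vector_space "scaleR :: real \<Rightarrow> 'a \<Rightarrow> 'a" B
    rewrites "module.subspace (scaleR :: real \<Rightarrow> 'a \<Rightarrow> 'a) = subspace"
      and "module.span (scaleR :: real \<Rightarrow> 'a \<Rightarrow> 'a) = span"
      and "vector_space.dim (scaleR :: real \<Rightarrow> 'a \<Rightarrow> 'a) = dim"
    by (rule fin) (simp_all add: subspace_raw_def span_raw_def dim_raw_def)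
  have "\<forall>y\<in>U. 0 \<le> ip (D y) y" if "subspace U" "D ` U \<subseteq> U" "T ` U \<subseteq> U" for U
    using that
  proof (induction "dim U" arbitrary: U rule: less_induct)
    case less
    show ?case
    proof (cases "U = {0}")
      case True
      then show ?thesis by (simp add: bil_simps)
    next
      case False
      obtain v m a where v: "v \<in> U" "v \<noteq> 0" "D v = m *\<^sub>R v" "T v = a *\<^sub>R v"
        by (rule commuting_symmetric_joint_eigenvector[OF fin ip D T comm less.prems False])
      have m: "0 \<le> m" using joint v by blast
      have vv: "0 < ip v v" using inner_product_pos[OF ip v(2)] .
      define W where "W = {x \<in> U. ip x v = 0}"
      have W: "subspace W"
        using less.prems(1) by (auto simp: W_def subspace_def bil_simps)
      have "D ` W \<subseteq> W" "T ` W \<subseteq> W"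
        using less.prems(2,3) by (auto simp: W_def sym v(3,4) bil_simps)
      moreover have "v \<notin> W" using vv by (simp add: W_def)
      then have "W \<subset> U" using v(1) by (auto simp: W_def)
      then have "dim W < dim U"
        using dim_psubset[of W U] W less.prems(1) by (simp add: span_eq_iff[THEN iffD2])
      ultimately have IH: "\<forall>y\<in>W. 0 \<le> ip (D y) y" using less.hyps W by blast
      show ?thesis
      proof
        fix y assume y: "y \<in> U"
        define t where "t = ip y v / ip v v"
        define w where "w = y - t *\<^sub>R v"
        have wv: "ip w v = 0" using vv by (simp add: w_def t_def bil_simps)
        have "w \<in> W"
          using wv y v(1) less.prems(1) by (auto simp: W_def w_def intro!: subspace_diff subspace_scale)
        then have "0 \<le> ip (D w) w" using IH by blast
        moreover have "ip (D w) v = 0" using wv by (simp add: sym v(3) bil_simps)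
        moreover have "ip v w = 0" using wv ip_comm by simp
        moreover have "y = w + t *\<^sub>R v" by (simp add: w_def)
        ultimately have "ip (D y) y = ip (D w) w + t\<^sup>2 * m * ip v v"
          by (simp add: linear_add[OF lin(1)] linear_scale[OF lin(1)] v(3) bil_simps power2_eq_square)
        then show "0 \<le> ip (D y) y" using \<open>0 \<le> ip (D w) w\<close> m vv by simp
      qed
    qed
  qed
  from this[of UNIV] show ?thesis by simp
qed

section \<open>The kernel of a multiplication operator in a Jordan algebra\<close>

context jordan_algebra
begin

lemmas jprod_simps =
  bilinear_ladd[OF jprod_bilinear] bilinear_radd[OF jprod_bilinear]
  bilinear_lsub[OF jprod_bilinear] bilinear_rsub[OF jprod_bilinear]
  bilinear_lmul[OF jprod_bilinear] bilinear_rmul[OF jprod_bilinear]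
  bilinear_lzero[OF jprod_bilinear] bilinear_rzero[OF jprod_bilinear]
  bilinear_lneg[OF jprod_bilinear] bilinear_rneg[OF jprod_bilinear]

lemma linear_jprod: "linear (\<lambda>y. x \<bullet>\<^sub>J y)"
  using jprod_bilinear by (simp add: bilinear_def)

text \<open>
  This is the part of the Jordan identity for \<open>x + w\<close> that is linear in \<open>w\<close>.  Subtracting the
  identity for \<open>x - w\<close> removes the parts of even degree in \<open>w\<close>; the cubic part is the Jordan
  identity for \<open>w\<close> itself.
\<close>

lemma jordan_identity_linearized:
  "w \<bullet>\<^sub>J ((x \<bullet>\<^sub>J x) \<bullet>\<^sub>J y) + 2 *\<^sub>R (x \<bullet>\<^sub>J ((x \<bullet>\<^sub>J w) \<bullet>\<^sub>J y)) =
   2 *\<^sub>R ((x \<bullet>\<^sub>J w) \<bullet>\<^sub>J (x \<bullet>\<^sub>J y)) + (x \<bullet>\<^sub>J x) \<bullet>\<^sub>J (w \<bullet>\<^sub>J y)"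
  (is "?L = ?R")
proof -
  have "2 *\<^sub>R ?L =
      (x + w) \<bullet>\<^sub>J (((x + w) \<bullet>\<^sub>J (x + w)) \<bullet>\<^sub>J y) - (x - w) \<bullet>\<^sub>J (((x - w) \<bullet>\<^sub>J (x - w)) \<bullet>\<^sub>J y)
      - 2 *\<^sub>R (w \<bullet>\<^sub>J ((w \<bullet>\<^sub>J w) \<bullet>\<^sub>J y))"
    by (simp add: jprod_simps jprod_commute[of w x] scaleR_2 algebra_simps)
  also have "\<dots> =
      ((x + w) \<bullet>\<^sub>J (x + w)) \<bullet>\<^sub>J ((x + w) \<bullet>\<^sub>J y) - ((x - w) \<bullet>\<^sub>J (x - w)) \<bullet>\<^sub>J ((x - w) \<bullet>\<^sub>J y)
      - 2 *\<^sub>R ((w \<bullet>\<^sub>J w) \<bullet>\<^sub>J (w \<bullet>\<^sub>J y))"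
    by (simp only: jordan_identity)
  also have "\<dots> = 2 *\<^sub>R ?R"
    by (simp add: jprod_simps jprod_commute[of w x] scaleR_2 algebra_simps)
  finally show ?thesis by simp
qed

text \<open>
  Both sides equal the product of \<open>z\<^sup>2\<close> and \<open>v\<^sup>2\<close>.  Linearizing the Jordan identity at \<open>z\<close> in the
  direction \<open>v\<close> shows it for one side, and exchanging the roles of \<open>z\<close> and \<open>v\<close> for the other;
  the hypothesis kills the mixed terms in both cases.
\<close>

lemma jprod_square_of_kernel:
  assumes "z \<bullet>\<^sub>J v = 0"
  shows "z \<bullet>\<^sub>J (z \<bullet>\<^sub>J (v \<bullet>\<^sub>J v)) = v \<bullet>\<^sub>J ((z \<bullet>\<^sub>J z) \<bullet>\<^sub>J v)"
proof -
  have vz: "v \<bullet>\<^sub>J z = 0" using assms by (simp add: jprod_commute)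
  have "v \<bullet>\<^sub>J ((z \<bullet>\<^sub>J z) \<bullet>\<^sub>J v) = (z \<bullet>\<^sub>J z) \<bullet>\<^sub>J (v \<bullet>\<^sub>J v)"
    using jordan_identity_linearized[of v z v] by (simp add: assms jprod_simps)
  also have "\<dots> = (v \<bullet>\<^sub>J v) \<bullet>\<^sub>J (z \<bullet>\<^sub>J z)" by (rule jprod_commute)
  also have "\<dots> = z \<bullet>\<^sub>J ((v \<bullet>\<^sub>J v) \<bullet>\<^sub>J z)"
    using jordan_identity_linearized[of z v z] by (simp add: vz jprod_simps)
  also have "\<dots> = z \<bullet>\<^sub>J (z \<bullet>\<^sub>J (v \<bullet>\<^sub>J v))" by (simp only: jprod_commute[of "v \<bullet>\<^sub>J v" z])
  finally show ?thesis ..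
qed

text \<open>
  By the preceding identity \<open>v\<^sup>2\<close> is an eigenvector, for the eigenvalue \<open>m\<close>, of the square of the
  symmetric operator of multiplication by \<open>z\<close>, so that \<open>m \<bar>v\<^sup>2\<bar>\<^sup>2 = \<bar>z v\<^sup>2\<bar>\<^sup>2\<close>.  It is nonzero
  because its inner product with the identity element is \<open>\<bar>v\<bar>\<^sup>2\<close>.
\<close>

lemma kernel_eigenvalue_square_nonneg:
  fixes ip :: "'a \<Rightarrow> 'a \<Rightarrow> real"
  assumes e: "\<And>x. x \<bullet>\<^sub>J e = x"
    and ip: "inner_product ip" and assoc: "associative_form jprod ip"
    and v: "v \<noteq> 0" and zv: "z \<bullet>\<^sub>J v = 0" and m: "(z \<bullet>\<^sub>J z) \<bullet>\<^sub>J v = m *\<^sub>R v"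
  shows "0 \<le> m"
proof -
  have bil: "bilinear ip" using ip by (simp add: inner_product_def)
  have assocD: "ip (x \<bullet>\<^sub>J y) w = ip x (y \<bullet>\<^sub>J w)" for x y w
    using assoc by (simp add: associative_form_def)
  let ?s = "v \<bullet>\<^sub>J v"
  have "ip v v = ip v (v \<bullet>\<^sub>J e)" by (simp add: e)
  also have "\<dots> = ip ?s e" by (simp add: assocD)
  finally have "?s \<noteq> 0" using inner_product_pos[OF ip v] bilinear_lzero[OF bil] by auto
  have "ip (z \<bullet>\<^sub>J ?s) (z \<bullet>\<^sub>J ?s) = ip ?s (z \<bullet>\<^sub>J (z \<bullet>\<^sub>J ?s))"
    by (simp add: jprod_commute[of z ?s] assocD)
  also have "\<dots> = m * ip ?s ?s"
    by (simp add: jprod_square_of_kernel[OF zv] m jprod_simps bilinear_rmul[OF bil])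
  finally have "m * ip ?s ?s = ip (z \<bullet>\<^sub>J ?s) (z \<bullet>\<^sub>J ?s)" by simp
  moreover have "0 \<le> ip (z \<bullet>\<^sub>J ?s) (z \<bullet>\<^sub>J ?s)"
    using inner_product_pos[OF ip, of "z \<bullet>\<^sub>J ?s"] bilinear_lzero[OF bil]
    by (cases "z \<bullet>\<^sub>J ?s = 0") auto
  ultimately show ?thesis
    using inner_product_pos[OF ip \<open>?s \<noteq> 0\<close>] by (metis not_less zero_le_mult_iff)
qed

text \<open>
  Replacing \<open>x\<close> by \<open>x - a e\<close> does not change the operator \<open>L(x\<^sup>2) - L(x)\<^sup>2\<close> and puts \<open>v\<close> into the
  kernel.
\<close>

lemma jprod_joint_eigenvalue_nonneg:
  fixes ip :: "'a \<Rightarrow> 'a \<Rightarrow> real"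
  assumes e: "\<And>x. x \<bullet>\<^sub>J e = x"
    and ip: "inner_product ip" and assoc: "associative_form jprod ip"
    and v: "v \<noteq> 0" and a: "x \<bullet>\<^sub>J v = a *\<^sub>R v"
    and m: "(x \<bullet>\<^sub>J x) \<bullet>\<^sub>J v - x \<bullet>\<^sub>J (x \<bullet>\<^sub>J v) = m *\<^sub>R v"
  shows "0 \<le> m"
proof -
  define z where "z = x - a *\<^sub>R e"
  have e': "e \<bullet>\<^sub>J y = y" for y using e jprod_commute by metis
  have zv: "z \<bullet>\<^sub>J v = 0" by (simp add: z_def jprod_simps a e')
  have "(x \<bullet>\<^sub>J x) \<bullet>\<^sub>J v = (m + a * a) *\<^sub>R v"
    using m by (simp add: a jprod_simps algebra_simps)
  then have "(z \<bullet>\<^sub>J z) \<bullet>\<^sub>J v = m *\<^sub>R v"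
    by (simp add: z_def jprod_simps a e e' algebra_simps)
  then show ?thesis by (rule kernel_eigenvalue_square_nonneg[OF e ip assoc v zv])
qed

end

section \<open>The inequality\<close>

theorem lemma4p2:
  fixes jprod :: "'a::real_vector \<Rightarrow> 'a \<Rightarrow> 'a"  (infixl \<open>\<bullet>\<^sub>J\<close> 70)
    and ip :: "'a \<Rightarrow> 'a \<Rightarrow> real"  (\<open>\<langle>_, _\<rangle>\<close>)
  assumes finite_dim: "\<exists>B. finite_dimensional_vector_space (scaleR :: real \<Rightarrow> 'a \<Rightarrow> 'a) B"
    and "formally_real_jordan_algebra jprod"
    and "inner_product ip"
    and "associative_form jprod ip"
  shows "\<forall>X Y. \<langle>X \<bullet>\<^sub>J Y, X \<bullet>\<^sub>J Y\<rangle> \<le> \<langle>X \<bullet>\<^sub>J X, Y \<bullet>\<^sub>J Y\<rangle>"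
proof (intro allI)
  fix X Y
  interpret formally_real_jordan_algebra jprod by fact
  obtain B where fin: "finite_dimensional_vector_space (scaleR :: real \<Rightarrow> 'a \<Rightarrow> 'a) B"
    using finite_dim by blast
  obtain e where e: "\<And>x. x \<bullet>\<^sub>J e = x" using identity_exists by blast
  have bil: "bilinear ip" and ip_comm: "\<langle>x, y\<rangle> = \<langle>y, x\<rangle>" for x y
    using \<open>inner_product ip\<close> by (simp_all add: inner_product_def)
  have assocD: "\<langle>x \<bullet>\<^sub>J y, w\<rangle> = \<langle>x, y \<bullet>\<^sub>J w\<rangle>" for x y w
    using \<open>associative_form jprod ip\<close> by (simp add: associative_form_def)
  have mult_sym: "\<langle>x \<bullet>\<^sub>J y, w\<rangle> = \<langle>y, x \<bullet>\<^sub>J w\<rangle>" for x y w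
    by (simp add: jprod_commute[of x y] assocD)
  define D where "D y = (X \<bullet>\<^sub>J X) \<bullet>\<^sub>J y - X \<bullet>\<^sub>J (X \<bullet>\<^sub>J y)" for y
  have T: "symmetric_operator ip (\<lambda>y. X \<bullet>\<^sub>J y)"
    using mult_sym by (simp add: symmetric_operator_def linear_jprod)
  have D: "symmetric_operator ip D"
    unfolding symmetric_operator_def
    by (auto intro!: linearI simp: D_def jprod_simps mult_sym bilinear_lsub[OF bil]
        bilinear_rsub[OF bil] algebra_simps)
  have "0 \<le> \<langle>D Y, Y\<rangle>"
  proof (rule commuting_symmetric_nonneg[OF fin \<open>inner_product ip\<close> D T])
    show "D (X \<bullet>\<^sub>J y) = X \<bullet>\<^sub>J D y" for y
      by (simp add: D_def jprod_simps jordan_identity)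
    show "0 \<le> m" if "v \<noteq> 0" "D v = m *\<^sub>R v" "X \<bullet>\<^sub>J v = a *\<^sub>R v" for v m a
      using jprod_joint_eigenvalue_nonneg[OF e \<open>inner_product ip\<close> \<open>associative_form jprod ip\<close>]
        that unfolding D_def by blast
  qed
  also have "\<langle>D Y, Y\<rangle> = \<langle>X \<bullet>\<^sub>J X, Y \<bullet>\<^sub>J Y\<rangle> - \<langle>X \<bullet>\<^sub>J Y, X \<bullet>\<^sub>J Y\<rangle>"
    by (simp add: D_def bilinear_lsub[OF bil] assocD[of "X \<bullet>\<^sub>J X"] mult_sym[of X "X \<bullet>\<^sub>J Y"])
  finally show "\<langle>X \<bullet>\<^sub>J Y, X \<bullet>\<^sub>J Y\<rangle> \<le> \<langle>X \<bullet>\<^sub>J X, Y \<bullet>\<^sub>J Y\<rangle>" by simp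
qed

end
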